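(* Let $n,k\geq 1$ be integers. Then $$\mathcal{F}^{(k)}(n)^{\mathrm{ab}}\cong\begin{cases} \mathbb{Z}_{F_{n+1}^k+F_{n-1}^k} & \text{if } n\equiv 1,5,7,11\bmod 12,\\ \mathbb{Z}_{\gcd(k+1,2)}\oplus\mathbb{Z}_{\frac{F_{n+1}^k+F_{n-1}^k}{\gcd(k+1,2)}} & \text{if } n\equiv 3,9\bmod 12,\\ \mathbb{Z}_{F_{n/2+1}^k+F_{n/2-1}^k}\oplus\mathbb{Z}_{F_{n/2+1}^k+F_{n/2-1}^k} & \text{if } n\equiv 2,6,10\bmod 12,\\ \mathbb{Z}_{\gcd(k,2)F_{n/2}^k}\oplus\mathbb{Z}_{\frac{(k^2+4)F_{n/2}^k}{\gcd(k,2)}} & \text{if } n\equiv 0,4,8\bmod 12. \end{cases}$$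
   Context: For an element $w=w(x_0,\dots,x_{n-1})$ of the free group on $x_0,\dots,x_{n-1}$, the cyclically presented group $G_n(w)$ is the group with presentation $\langle x_0,\dots,x_{n-1}\mid w(x_i,x_{i+1},\dots,x_{i+n-1})\ (0\le i<n)\rangle$, subscripts taken mod $n$. The fractional Fibonacci group is $\mathcal{F}^{(k)}(n)=G_n(x_0x_1^kx_2^{-1})$ (subscripts mod $n$). $G^{\mathrm{ab}}$ denotes the abelianization of $G$, and $\mathbb{Z}_m=\mathbb{Z}/m\mathbb{Z}$. The fractional Fibonacci numbers are defined by $F_0^k=0$, $F_1^k=1$, $F_{j+2}^k=kF_{j+1}^k+F_j^k$ for $j\ge 0$ (here $k$ is a superscript index, not a power). *)

theory Defs
  imports "HOL-Algebra.Algebra"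
begin

section \<open>Free groups and presentations\<close>

text \<open>A letter \<open>(x, True)\<close> is the generator \<open>x\<close>, and \<open>(x, False)\<close> is its formal inverse.  The free
  group on \<open>S\<close> consists of the reduced words over \<open>S\<close>; a product is the reduced form of the
  concatenation, obtained by prepending the letters of the left factor one at a time.\<close>

type_synonym 'a word = "('a \<times> bool) list"

definition inverse_letters :: "'a \<times> bool \<Rightarrow> 'a \<times> bool \<Rightarrow> bool" where
  "inverse_letters a b \<longleftrightarrow> fst a = fst b \<and> snd a \<noteq> snd b"

definition reduced :: "'a word \<Rightarrow> bool" where
  "reduced = successively (\<lambda>a b. \<not> inverse_letters a b)"

fun prepend :: "'a \<times> bool \<Rightarrow> 'a word \<Rightarrow> 'a word" where
  "prepend a [] = [a]"
| "prepend a (b # u) = (if inverse_letters a b then u else a # b # u)"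

definition free_group :: "'a set \<Rightarrow> 'a word monoid" where
  "free_group S =
     \<lparr>carrier = {u. reduced u \<and> fst ` set u \<subseteq> S}, monoid.mult = (\<lambda>u v. foldr prepend u v), one = []\<rparr>"

definition generator :: "'a \<Rightarrow> 'a word" where
  "generator x = [(x, True)]"

definition normal_closure :: "('a, 'b) monoid_scheme \<Rightarrow> 'a set \<Rightarrow> 'a set" where
  "normal_closure G R = \<Inter> {N. N \<lhd> G \<and> R \<subseteq> N}"

definition presented_group :: "'a set \<Rightarrow> 'a word set \<Rightarrow> 'a word set monoid" where
  "presented_group S R = free_group S Mod normal_closure (free_group S) R"

definition abelianization :: "('a, 'b) monoid_scheme \<Rightarrow> 'a set monoid" where
  "abelianization G = G Mod derived G (carrier G)"

lemma reduced_prepend: "reduced u \<Longrightarrow> reduced (prepend a u)"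
  by (cases u) (auto simp: reduced_def successively_Cons)

lemma prepend_prepend_inverse:
  assumes "inverse_letters a b" "reduced u"
  shows "prepend a (prepend b u) = u"
proof (cases u)
  case Nil
  then show ?thesis using assms by simp
next
  case (Cons c v)
  show ?thesis
  proof (cases "inverse_letters b c")
    case True
    then have "a = c" using assms(1) by (auto simp: inverse_letters_def prod_eq_iff)
    then show ?thesis using Cons True assms(2)
      by (cases v) (auto simp: reduced_def)
  qed (use Cons assms in auto)
qed

lemma reduced_foldr_prepend: "reduced v \<Longrightarrow> reduced (foldr prepend u v)"
  by (induction u) (auto intro: reduced_prepend)

lemma letters_prepend: "set (prepend a u) \<subseteq> insert a (set u)"
  by (cases u) auto

lemma letters_foldr_prepend: "set (foldr prepend u v) \<subseteq> set u \<union> set v"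
  by (induction u) (use letters_prepend in fastforce)+

lemma foldr_prepend_reduced: "reduced u \<Longrightarrow> foldr prepend u [] = u"
proof (induction u)
  case (Cons a u)
  then show ?case by (cases u) (auto simp: reduced_def)
qed simp

lemma foldr_prepend_prepend:
  assumes "reduced v"
  shows "foldr prepend (prepend a u) v = prepend a (foldr prepend u v)"
proof (cases u)
  case (Cons b t)
  then show ?thesis
    using prepend_prepend_inverse[of a b "foldr prepend t v"] reduced_foldr_prepend[OF assms]
    by auto
qed simp

lemma foldr_prepend_assoc:
  assumes "reduced w"
  shows "foldr prepend (foldr prepend u v) w = foldr prepend u (foldr prepend v w)"
  by (induction u) (simp_all add: foldr_prepend_prepend[OF assms])

lemma foldr_prepend_inverse:
  assumes "reduced v"
  shows "foldr prepend (rev (map (apsnd Not) u)) (foldr prepend u v) = v"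
proof (induction u)
  case (Cons a u)
  have "inverse_letters (apsnd Not a) a" by (simp add: inverse_letters_def)
  then show ?case
    using Cons prepend_prepend_inverse[OF _ reduced_foldr_prepend[OF assms]] by simp
qed simp

lemma group_free_group: "group (free_group S)"
proof (rule groupI)
  fix u assume u: "u \<in> carrier (free_group S)"
  have "reduced (rev (map (apsnd Not) u))"
    using u by (auto simp: free_group_def reduced_def successively_map inverse_letters_def
      elim!: successively_mono)
  then have "rev (map (apsnd Not) u) \<in> carrier (free_group S)"
    using u by (auto simp: free_group_def)
  moreover have "rev (map (apsnd Not) u) \<otimes>\<^bsub>free_group S\<^esub> u = \<one>\<^bsub>free_group S\<^esub>"
    using foldr_prepend_inverse[of "[]" u] u
    by (simp add: free_group_def foldr_prepend_reduced) (simp add: reduced_def)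
  ultimately show "\<exists>v\<in>carrier (free_group S). v \<otimes>\<^bsub>free_group S\<^esub> u = \<one>\<^bsub>free_group S\<^esub>"
    by blast
next
  fix u v
  assume "u \<in> carrier (free_group S)" "v \<in> carrier (free_group S)"
  then show "u \<otimes>\<^bsub>free_group S\<^esub> v \<in> carrier (free_group S)"
    using letters_foldr_prepend[of u v] by (fastforce simp: free_group_def reduced_foldr_prepend)
qed (auto simp: free_group_def foldr_prepend_assoc reduced_def)

section \<open>Cyclically presented groups\<close>

text \<open>If \<open>u\<close> represents \<open>w(x\<^sub>0, \<dots>, x\<^sub>n\<^sub>-\<^sub>1)\<close>, then \<open>shift_word n i u\<close> represents
  \<open>w(x\<^sub>i, \<dots>, x\<^sub>i\<^sub>+\<^sub>n\<^sub>-\<^sub>1)\<close> with subscripts modulo \<open>n\<close>.  Shifting permutes the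
  generators \<open>{..<n}\<close>, so it preserves reducedness.\<close>

definition shift_word :: "nat \<Rightarrow> nat \<Rightarrow> nat word \<Rightarrow> nat word" where
  "shift_word n i = map (apfst (\<lambda>j. (j + i) mod n))"

definition cyclically_presented_group :: "nat \<Rightarrow> nat word \<Rightarrow> nat word set monoid" where
  "cyclically_presented_group n w = presented_group {..<n} ((\<lambda>i. shift_word n i w) ` {..<n})"

definition fractional_Fibonacci_word :: "nat \<Rightarrow> nat \<Rightarrow> nat word" where
  "fractional_Fibonacci_word k n =
     generator 0 \<otimes>\<^bsub>free_group {..<n}\<^esub> generator (1 mod n) [^]\<^bsub>free_group {..<n}\<^esub> k
       \<otimes>\<^bsub>free_group {..<n}\<^esub> inv\<^bsub>free_group {..<n}\<^esub> generator (2 mod n)"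

definition fractional_Fibonacci_group :: "nat \<Rightarrow> nat \<Rightarrow> nat word set monoid" where
  "fractional_Fibonacci_group k n = cyclically_presented_group n (fractional_Fibonacci_word k n)"

fun fractional_fib :: "nat \<Rightarrow> nat \<Rightarrow> nat" where
  "fractional_fib k 0 = 0"
| "fractional_fib k (Suc 0) = 1"
| "fractional_fib k (Suc (Suc j)) = k * fractional_fib k (Suc j) + fractional_fib k j"

end

theory Submission
  imports Defs
begin

text \<open>The abelianization is generated by the images of \<open>x\<^sub>0\<close> and \<open>x\<^sub>1\<close>, since
  \<open>x\<^sub>j\<^sub>+\<^sub>1 = F\<^sub>j x\<^sub>0 + F\<^sub>j\<^sub>+\<^sub>1 x\<^sub>1\<close> there, and the only remaining relations are
  \<open>x\<^sub>n = x\<^sub>0\<close> and \<open>x\<^sub>n\<^sub>+\<^sub>1 = x\<^sub>1\<close>.  With \<open>p = F\<^sub>n\<^sub>-\<^sub>1 - 1\<close> and \<open>q = F\<^sub>n\<close> it is therefore the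
  quotient of the integer plane by the rows of the symmetric matrix with entries
  \<open>p, q, q, p + k q\<close>, whose Smith normal form is \<open>(d, D / d)\<close> for \<open>d = gcd p q\<close> and
  \<open>D = |p\<^sup>2 + k p q - q\<^sup>2|\<close>.  Cassini's identity evaluates \<open>d\<close> and \<open>D\<close>; for \<open>n = 2 m\<close> the
  duplication formulas exhibit \<open>F\<^sub>m\<^sub>+\<^sub>1 + F\<^sub>m\<^sub>-\<^sub>1\<close> (\<open>m\<close> odd) or \<open>F\<^sub>m\<close> (\<open>m\<close> even) as a common
  factor of \<open>p\<close> and \<open>q\<close>.\<close>

section \<open>Evaluating words\<close>

text \<open>The homomorphism out of the free group with prescribed images \<open>y\<close> of the
  generators. It is defined on all words, reduced or not, so that inductions on words need no
  reducedness.\<close>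

definition word_eval :: "('b, 'c) monoid_scheme \<Rightarrow> ('a \<Rightarrow> 'b) \<Rightarrow> 'a word \<Rightarrow> 'b" where
  "word_eval G y w =
     foldr (\<lambda>a g. (if snd a then y (fst a) else inv\<^bsub>G\<^esub> y (fst a)) \<otimes>\<^bsub>G\<^esub> g) w \<one>\<^bsub>G\<^esub>"

lemma word_eval_Nil [simp]: "word_eval G y [] = \<one>\<^bsub>G\<^esub>"
  by (simp add: word_eval_def)

lemma word_eval_Cons [simp]:
  "word_eval G y (a # w) =
     (if snd a then y (fst a) else inv\<^bsub>G\<^esub> y (fst a)) \<otimes>\<^bsub>G\<^esub> word_eval G y w"
  by (simp add: word_eval_def)

lemma word_eval_shift_word:
  "word_eval G y (shift_word n i w) = word_eval G (\<lambda>j. y ((j + i) mod n)) w"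
  by (induction w) (simp_all add: shift_word_def)

context group
begin

lemma word_eval_closed:
  "y \<in> S \<rightarrow> carrier G \<Longrightarrow> fst ` set w \<subseteq> S \<Longrightarrow> word_eval G y w \<in> carrier G"
  by (induction w) auto

text \<open>If \<open>prepend\<close> cancels two inverse letters, their values cancel in
  \<open>G\<close> as well.\<close>

lemma word_eval_prepend:
  assumes y: "y \<in> S \<rightarrow> carrier G" and a: "fst a \<in> S" and w: "fst ` set w \<subseteq> S"
  shows "word_eval G y (prepend a w) = word_eval G y (a # w)"
proof (cases w)
  case (Cons b u)
  have [simp]: "word_eval G y u \<in> carrier G" "y (fst b) \<in> carrier G"
    using w Cons word_eval_closed[OF y] y by auto
  show ?thesis
    using Cons by (auto simp: inverse_letters_def m_assoc[symmetric])
qed simp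

lemma word_eval_foldr_prepend:
  assumes y: "y \<in> S \<rightarrow> carrier G" and u: "fst ` set u \<subseteq> S" and w: "fst ` set w \<subseteq> S"
  shows "word_eval G y (foldr prepend u w) = word_eval G y u \<otimes> word_eval G y w"
  using u
proof (induction u)
  case Nil
  then show ?case using word_eval_closed[OF y w] by simp
next
  case (Cons a u)
  have a: "fst a \<in> S" and u: "fst ` set u \<subseteq> S" using Cons.prems by auto
  have "fst ` set (foldr prepend u w) \<subseteq> S"
    using letters_foldr_prepend[of u w] u w by blast
  moreover have "y (fst a) \<in> carrier G" using y a by auto
  ultimately show ?case
    using Cons.IH[OF u] word_eval_prepend[OF y a] word_eval_closed[OF y u] word_eval_closed[OF y w]
    by (auto simp: m_assoc)
qed

lemma word_eval_hom:
  assumes "y \<in> S \<rightarrow> carrier G"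
  shows "word_eval G y \<in> hom (free_group S) G"
proof (rule homI)
  fix u v
  assume "u \<in> carrier (free_group S)" "v \<in> carrier (free_group S)"
  then show "word_eval G y (u \<otimes>\<^bsub>free_group S\<^esub> v) = word_eval G y u \<otimes> word_eval G y v"
    using word_eval_foldr_prepend[OF assms] by (simp add: free_group_def)
qed (use word_eval_closed[OF assms] in \<open>simp add: free_group_def\<close>)

end

lemma generator_in_free_group: "x \<in> S \<Longrightarrow> generator x \<in> carrier (free_group S)"
  by (simp add: generator_def free_group_def reduced_def)

lemma inv_generator:
  assumes "x \<in> S"
  shows "inv\<^bsub>free_group S\<^esub> generator x = [(x, False)]"
proof -
  interpret F: group "free_group S" by (rule group_free_group)
  show ?thesis
    by (rule F.inv_equality)
      (use assms in \<open>auto simp: generator_def free_group_def reduced_def inverse_letters_def\<close>)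
qed

text \<open>The first letter of a reduced word does not cancel against its tail, so the word is the
  product of the two in the free group, and induction reduces \<open>f\<close> to its values on
  generators.\<close>

lemma hom_eq_word_eval:
  assumes G: "group G" and f: "f \<in> hom (free_group S) G" and w: "w \<in> carrier (free_group S)"
  shows "f w = word_eval G (\<lambda>x. f (generator x)) w"
  using w
proof (induction w)
  interpret group_hom "free_group S" G f
    by (intro group_hom.intro group_hom_axioms.intro group_free_group G f)
  case Nil
  show ?case using hom_one by (simp add: free_group_def)
next
  interpret group_hom "free_group S" G f
    by (intro group_hom.intro group_hom_axioms.intro group_free_group G f)
  case (Cons a w)
  have red: "reduced (a # w)" and a: "fst a \<in> S" and w: "w \<in> carrier (free_group S)"
    using Cons.prems by (auto simp: free_group_def reduced_def successively_Cons)
  have "prepend a w = a # w"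
    using red by (cases w) (auto simp: reduced_def)
  then have "a # w = [a] \<otimes>\<^bsub>free_group S\<^esub> w"
    by (simp add: free_group_def)
  moreover have "[a] \<in> carrier (free_group S)"
    using a by (simp add: free_group_def reduced_def)
  ultimately have "f (a # w) = f [a] \<otimes>\<^bsub>G\<^esub> f w"
    using w by simp
  moreover have "f [a] = (if snd a then f (generator (fst a)) else inv\<^bsub>G\<^esub> f (generator (fst a)))"
    using hom_inv[OF generator_in_free_group[OF a]] inv_generator[OF a]
    by (cases a) (auto simp: generator_def)
  ultimately show ?case
    using Cons.IH[OF w] by simp
qed

section \<open>The abelianization of a presented group\<close>

lemma normal_normal_closure:
  assumes "group G" "R \<subseteq> carrier G"
  shows "normal_closure G R \<lhd> G"
proof -
  interpret group G by fact
  \<comment> \<open>The family of normal subgroups to be intersected is nonempty.\<close>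
  have "carrier G \<in> {N. N \<lhd> G \<and> R \<subseteq> N}"
    using assms(2) subgroup_self by (auto simp: normal_inv_iff)
  moreover have "subgroup (normal_closure G R) G"
    unfolding normal_closure_def
    by (rule subgroups_Inter) (use calculation in \<open>auto simp: normal_inv_iff\<close>)
  ultimately show ?thesis
    unfolding normal_inv_iff by (auto simp: normal_closure_def normal_inv_iff)
qed

lemma subset_normal_closure: "R \<subseteq> normal_closure G R"
  by (auto simp: normal_closure_def)

lemma normal_closure_minimal: "N \<lhd> G \<Longrightarrow> R \<subseteq> N \<Longrightarrow> normal_closure G R \<subseteq> N"
  by (auto simp: normal_closure_def)

text \<open>The composite of the two quotient maps: a word goes to its coset modulo the normal
  closure, and this to its coset modulo the derived subgroup.\<close>

definition abelianized_class :: "'a set \<Rightarrow> 'a word set \<Rightarrow> 'a word \<Rightarrow> 'a word set set" where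
  "abelianized_class S R w =
     derived (presented_group S R) (carrier (presented_group S R))
       #>\<^bsub>presented_group S R\<^esub> (normal_closure (free_group S) R #>\<^bsub>free_group S\<^esub> w)"

locale presentation =
  fixes S :: "'a set" and R :: "'a word set"
  assumes relators: "R \<subseteq> carrier (free_group S)"
begin

abbreviation "P \<equiv> presented_group S R"
abbreviation "A \<equiv> abelianization P"
abbreviation "N \<equiv> normal_closure (free_group S) R"
abbreviation "cls \<equiv> abelianized_class S R"

lemma normal_N: "N \<lhd> free_group S"
  by (rule normal_normal_closure[OF group_free_group relators])

lemma group_P: "group P"
  unfolding presented_group_def by (rule normal.factorgroup_is_group[OF normal_N])

lemma comm_group_A: "comm_group A"
  unfolding abelianization_def by (rule group.derived_quot_is_comm_group[OF group_P])

lemma normal_derived: "derived P (carrier P) \<lhd> P"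
  using group.derived_self_is_normal[OF group_P] .

lemma cls_hom: "cls \<in> hom (free_group S) A"
proof -
  have "(\<lambda>w. N #>\<^bsub>free_group S\<^esub> w) \<in> hom (free_group S) P"
    unfolding presented_group_def by (rule normal.r_coset_hom_Mod[OF normal_N])
  moreover have "(\<lambda>p. derived P (carrier P) #>\<^bsub>P\<^esub> p) \<in> hom P A"
    unfolding abelianization_def by (rule normal.r_coset_hom_Mod[OF normal_derived])
  ultimately show ?thesis
    using hom_compose[of _ "free_group S" P _ A]
    by (fastforce simp: abelianized_class_def[abs_def] o_def)
qed

lemma cls_surj: "cls ` carrier (free_group S) = carrier A"
  by (auto simp: abelianization_def carrier_FactGroup abelianized_class_def
      presented_group_def image_iff)

lemma cls_relator:
  assumes "r \<in> R"
  shows "cls r = \<one>\<^bsub>A\<^esub>"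
proof -
  have "r \<in> N" by (rule subsetD[OF subset_normal_closure assms])
  then have "N #>\<^bsub>free_group S\<^esub> r = \<one>\<^bsub>P\<^esub>"
    using subgroup.rcos_const[OF normal_imp_subgroup[OF normal_N] group_free_group]
    by (simp add: presented_group_def)
  moreover have "derived P (carrier P) #>\<^bsub>P\<^esub> \<one>\<^bsub>P\<^esub> = \<one>\<^bsub>A\<^esub>"
    unfolding abelianization_def
    using subgroup.rcos_const[OF normal_imp_subgroup[OF normal_derived] group_P
        subgroup.one_closed[OF normal_imp_subgroup[OF normal_derived]]]
    by simp
  ultimately show ?thesis
    unfolding abelianized_class_def by metis
qed

text \<open>\<open>word_eval C y\<close> kills the relators, hence their normal closure, and factors
  through \<open>P\<close>; as \<open>C\<close> is commutative, the map obtained kills the derived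
  subgroup and factors through \<open>A\<close>.\<close>

lemma abelianization_universal:
  assumes C: "comm_group C" and y: "y \<in> S \<rightarrow> carrier C"
    and rel: "\<And>r. r \<in> R \<Longrightarrow> word_eval C y r = \<one>\<^bsub>C\<^esub>"
  obtains f where "f \<in> hom A C" "\<And>x. x \<in> S \<Longrightarrow> f (cls (generator x)) = y x"
proof -
  interpret C: comm_group C by (rule C)
  interpret e: group_hom "free_group S" C "word_eval C y"
    by (intro group_hom.intro group_hom_axioms.intro group_free_group C.word_eval_hom y
        C.is_group)
  have "N \<subseteq> kernel (free_group S) C (word_eval C y)"
    using relators rel
    by (intro normal_closure_minimal e.normal_kernel) (auto simp: kernel_def)
  then obtain g where g: "g \<in> hom P C"
      "\<And>w. w \<in> carrier (free_group S) \<Longrightarrow> g (N #>\<^bsub>free_group S\<^esub> w) = word_eval C y w"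
    by (rule e.FactGroup_universal_kernel[OF normal_N, folded presented_group_def]) (rule that)
  interpret g: group_hom P C g
    by (intro group_hom.intro group_hom_axioms.intro group_P g C.is_group)
  have "g ` carrier P \<subseteq> carrier C"
    by (auto intro: g.hom_closed)
  \<comment> \<open>A homomorphism maps the derived subgroup onto that of the image, which is
    trivial inside the commutative group \<open>C\<close>.\<close>
  then have "g ` derived P (carrier P) = {\<one>\<^bsub>C\<^esub>}"
    using g.derived_img[OF subset_refl] C.derived_eq_singleton by metis
  then have "derived P (carrier P) \<subseteq> kernel P C g"
    using group.derived_in_carrier[OF group_P subset_refl] unfolding kernel_def by blast
  then obtain f where f: "f \<in> hom A C"
      "\<And>p. p \<in> carrier P \<Longrightarrow> f (derived P (carrier P) #>\<^bsub>P\<^esub> p) = g p"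
    by (rule g.FactGroup_universal_kernel[OF normal_derived, folded abelianization_def])
      (rule that)
  show thesis
  proof
    fix x assume x: "x \<in> S"
    then have "N #>\<^bsub>free_group S\<^esub> generator x \<in> carrier P"
      unfolding presented_group_def carrier_FactGroup
      by (intro imageI generator_in_free_group)
    then have "f (cls (generator x)) = word_eval C y (generator x)"
      by (simp add: abelianized_class_def f(2) g(2) generator_in_free_group x)
    then show "f (cls (generator x)) = y x"
      using Pi_mem[OF y x] by (simp add: generator_def)
  qed (rule f(1))
qed

end

section \<open>The abelianized fractional Fibonacci groups\<close>

lemma add_mod_left_cancel:
  fixes a b i n :: nat
  assumes "(a + i) mod n = (b + i) mod n" "a < n" "b < n"
  shows "a = b"
proof -
  have "(int a + int i) mod int n = (int b + int i) mod int n"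
    using assms(1) by (metis of_nat_add of_nat_mod)
  then have "int a mod int n = int b mod int n"
    by (metis add_diff_cancel_right' mod_diff_left_eq)
  then show ?thesis using assms by simp
qed

lemma shift_word_closed:
  assumes w: "w \<in> carrier (free_group {..<n})" and n: "n > 0"
  shows "shift_word n i w \<in> carrier (free_group {..<n})"
proof -
  have "successively (\<lambda>a b. \<not> inverse_letters (apfst (\<lambda>j. (j + i) mod n) a)
      (apfst (\<lambda>j. (j + i) mod n) b)) w"
  proof (rule successively_mono)
    show "successively (\<lambda>a b. \<not> inverse_letters a b) w"
      using w by (simp add: free_group_def reduced_def)
    fix a b
    assume "a \<in> set w" "b \<in> set w" "\<not> inverse_letters a b"
    moreover from this w have "fst a < n" "fst b < n" by (auto simp: free_group_def)
    \<comment> \<open>The shift is injective on subscripts below \<open>n\<close>, so it creates no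
      new inverse pair.\<close>
    ultimately show "\<not> inverse_letters (apfst (\<lambda>j. (j + i) mod n) a) (apfst (\<lambda>j. (j + i) mod n) b)"
      using add_mod_left_cancel[of "fst a" i n "fst b"] by (auto simp: inverse_letters_def)
  qed
  then show ?thesis
    using n by (auto simp: free_group_def reduced_def shift_word_def successively_map)
qed

lemma fractional_Fibonacci_word_closed:
  assumes "n > 0"
  shows "fractional_Fibonacci_word k n \<in> carrier (free_group {..<n})"
proof -
  interpret F: group "free_group {..<n}" by (rule group_free_group)
  show ?thesis
    unfolding fractional_Fibonacci_word_def
    by (intro F.m_closed F.nat_pow_closed F.inv_closed generator_in_free_group) (use assms in auto)
qed

text \<open>The word is evaluated through the homomorphism property and not letter by letter, so its
  reduced form, in which letters may cancel for small \<open>n\<close>, is never computed.\<close>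

lemma (in group) word_eval_shift_fractional_Fibonacci_word:
  assumes y: "y \<in> {..<n} \<rightarrow> carrier G" and n: "n > 0"
  shows "word_eval G y (shift_word n i (fractional_Fibonacci_word k n)) =
    y (i mod n) \<otimes> y (Suc i mod n) [^] k \<otimes> inv y (Suc (Suc i) mod n)"
proof -
  define z where "z j = y ((j + i) mod n)" for j
  have z: "z \<in> {..<n} \<rightarrow> carrier G"
    using y n by (auto simp: z_def)
  interpret e: group_hom "free_group {..<n}" G "word_eval G z"
    by (intro group_hom.intro group_hom_axioms.intro group_free_group word_eval_hom z is_group)
  have gen: "word_eval G z (generator j) = z j" "generator j \<in> carrier (free_group {..<n})"
    if "j < n" for j
    using that Pi_mem[OF z, of j] by (simp_all add: generator_def generator_in_free_group[unfolded generator_def])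
  have "word_eval G z (fractional_Fibonacci_word k n) = z 0 \<otimes> z (1 mod n) [^] k \<otimes> inv z (2 mod n)"
    unfolding fractional_Fibonacci_word_def
    using n by (simp add: gen e.hom_nat_pow)
  then show ?thesis
    using n by (simp add: word_eval_shift_word z_def[abs_def] mod_simps)
qed

section \<open>The periodic sequence of generators and its recurrence\<close>

locale fractional_Fibonacci =
  fixes k n :: nat
  assumes n_pos: "n > 0"

sublocale fractional_Fibonacci \<subseteq> presentation "{..<n}"
  "(\<lambda>i. shift_word n i (fractional_Fibonacci_word k n)) ` {..<n}"
  by standard (use shift_word_closed fractional_Fibonacci_word_closed n_pos in blast)

context fractional_Fibonacci
begin

text \<open>Indexed by all naturals, so that the recurrence can be stated without modular
  subscripts.\<close>

definition gen :: "nat \<Rightarrow> nat word set set" where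
  "gen i = cls (generator (i mod n))"

lemma abelianization_eq: "abelianization (fractional_Fibonacci_group k n) = A"
  by (simp add: fractional_Fibonacci_group_def cyclically_presented_group_def)

sublocale A: comm_group A
  by (rule comm_group_A)

lemma gen_closed [simp]: "gen i \<in> carrier A"
  unfolding gen_def using n_pos
  by (intro hom_in_carrier[OF cls_hom] generator_in_free_group) simp

lemma gen_periodic [simp]: "gen (i + n) = gen i"
  by (simp add: gen_def)

lemma gen_rec: "gen (Suc (Suc i)) = gen (Suc i) [^]\<^bsub>A\<^esub> k \<otimes>\<^bsub>A\<^esub> gen i"
proof -
  have closed: "fractional_Fibonacci_word k n \<in> carrier (free_group {..<n})"
    by (rule fractional_Fibonacci_word_closed[OF n_pos])
  \<comment> \<open>Relators are indexed below \<open>n\<close>; the one needed for \<open>i\<close>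
    sits at \<open>i mod n\<close>.\<close>
  define r where "r = shift_word n (i mod n) (fractional_Fibonacci_word k n)"
  have "cls r = \<one>\<^bsub>A\<^esub>"
    unfolding r_def by (intro cls_relator imageI) (simp add: n_pos)
  moreover have "cls r = word_eval A (\<lambda>x. cls (generator x)) r"
    unfolding r_def by (intro hom_eq_word_eval[OF A.is_group cls_hom] shift_word_closed closed n_pos)
  moreover have "(\<lambda>x. cls (generator x)) \<in> {..<n} \<rightarrow> carrier A"
    by (intro Pi_I hom_in_carrier[OF cls_hom] generator_in_free_group)
  ultimately have "gen i \<otimes>\<^bsub>A\<^esub> gen (Suc i) [^]\<^bsub>A\<^esub> k \<otimes>\<^bsub>A\<^esub> inv\<^bsub>A\<^esub> gen (Suc (Suc i)) = \<one>\<^bsub>A\<^esub>"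
    unfolding r_def using n_pos
    by (simp add: A.word_eval_shift_fractional_Fibonacci_word gen_def mod_simps)
  then have "gen i \<otimes>\<^bsub>A\<^esub> gen (Suc i) [^]\<^bsub>A\<^esub> k = gen (Suc (Suc i))"
    by (metis A.inv_equality A.inv_inv A.inv_closed A.m_closed A.nat_pow_closed gen_closed)
  then show ?thesis
    by (simp add: A.m_comm)
qed

lemma gen_Suc:
  "gen (Suc i) = gen 0 [^]\<^bsub>A\<^esub> fractional_fib k i \<otimes>\<^bsub>A\<^esub> gen 1 [^]\<^bsub>A\<^esub> fractional_fib k (Suc i)"
proof (induction i rule: induct_nat_012)
  case 0
  show ?case by simp
next
  case 1
  show ?case using gen_rec[of 0] by (simp add: A.m_comm)
next
  case (ge2 j)
  show ?case
    unfolding gen_rec[of "Suc j"] ge2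
    by (simp add: A.nat_pow_distrib A.nat_pow_pow A.nat_pow_mult[symmetric] A.m_ac
        mult.commute distrib_left)
qed

text \<open>Products of powers of \<open>gen 0\<close> and \<open>gen 1\<close> form a subgroup
  because \<open>A\<close> is abelian, and by \<open>gen_Suc\<close> this subgroup contains every
  generator.\<close>

lemma ex_gen_powers:
  assumes "p \<in> carrier A"
  obtains a b :: int where "p = gen 0 [^]\<^bsub>A\<^esub> a \<otimes>\<^bsub>A\<^esub> gen 1 [^]\<^bsub>A\<^esub> b"
proof -
  define Q where "Q = {p. \<exists>(a::int) (b::int). p = gen 0 [^]\<^bsub>A\<^esub> a \<otimes>\<^bsub>A\<^esub> gen 1 [^]\<^bsub>A\<^esub> b}"
  have QI: "gen 0 [^]\<^bsub>A\<^esub> a \<otimes>\<^bsub>A\<^esub> gen 1 [^]\<^bsub>A\<^esub> b \<in> Q" for a b :: int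
    unfolding Q_def mem_Collect_eq by (rule exI[of _ a], rule exI[of _ b], rule refl)
  have mult: "u \<otimes>\<^bsub>A\<^esub> v \<in> Q" if uv: "u \<in> Q" "v \<in> Q" for u v
  proof -
    obtain a b :: int where u: "u = gen 0 [^]\<^bsub>A\<^esub> a \<otimes>\<^bsub>A\<^esub> gen 1 [^]\<^bsub>A\<^esub> b"
      using uv(1) unfolding Q_def mem_Collect_eq by (elim exE)
    obtain c d :: int where v: "v = gen 0 [^]\<^bsub>A\<^esub> c \<otimes>\<^bsub>A\<^esub> gen 1 [^]\<^bsub>A\<^esub> d"
      using uv(2) unfolding Q_def mem_Collect_eq by (elim exE)
    have "u \<otimes>\<^bsub>A\<^esub> v = gen 0 [^]\<^bsub>A\<^esub> (a + c) \<otimes>\<^bsub>A\<^esub> gen 1 [^]\<^bsub>A\<^esub> (b + d)"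
      unfolding u v by (simp add: A.int_pow_mult A.m_ac)
    then show ?thesis using QI by simp
  qed
  have inv: "inv\<^bsub>A\<^esub> u \<in> Q" if u: "u \<in> Q" for u
  proof -
    obtain a b :: int where ab: "u = gen 0 [^]\<^bsub>A\<^esub> a \<otimes>\<^bsub>A\<^esub> gen 1 [^]\<^bsub>A\<^esub> b"
      using u unfolding Q_def mem_Collect_eq by (elim exE)
    have "inv\<^bsub>A\<^esub> u = gen 0 [^]\<^bsub>A\<^esub> (- a) \<otimes>\<^bsub>A\<^esub> gen 1 [^]\<^bsub>A\<^esub> (- b)"
      unfolding ab by (simp add: A.int_pow_neg A.inv_mult)
    then show ?thesis using QI by simp
  qed
  have one: "\<one>\<^bsub>A\<^esub> \<in> Q"
    using QI[of 0 0] by simp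
  have gens: "gen i \<in> Q" for i
  proof (cases i)
    case 0
    then show ?thesis using QI[of 1 0] by simp
  next
    case (Suc j)
    show ?thesis
      using QI[of "int (fractional_fib k j)" "int (fractional_fib k (Suc j))"]
      unfolding Suc gen_Suc int_pow_int .
  qed
  obtain w where w: "w \<in> carrier (free_group {..<n})" "p = cls w"
    using assms cls_surj by (metis imageE)
  have "p = word_eval A (\<lambda>x. cls (generator x)) w"
    unfolding w(2) by (rule hom_eq_word_eval[OF A.is_group cls_hom w(1)])
  also have "fst ` set w \<subseteq> {..<n}"
    using w(1) by (simp add: free_group_def)
  then have "word_eval A (\<lambda>x. cls (generator x)) w \<in> Q"
  proof (induction w)
    case (Cons a w)
    then have "cls (generator (fst a)) = gen (fst a)" by (simp add: gen_def)
    then show ?case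
      using Cons mult inv gens by simp
  qed (simp add: one)
  finally have "p \<in> Q" .
  then show thesis using that unfolding Q_def mem_Collect_eq by (elim exE)
qed

text \<open>The converse of \<open>gen_rec\<close>: the recurrence and the period make every relator
  trivial under \<open>z\<close>, so the universal property applies.\<close>

lemma hom_from_recurrence:
  assumes C: "comm_group C" and z: "\<And>i. z i \<in> carrier C" and per: "\<And>i. z (i + n) = z i"
    and rec: "\<And>i. z (Suc (Suc i)) = z (Suc i) [^]\<^bsub>C\<^esub> k \<otimes>\<^bsub>C\<^esub> z i"
  obtains f where "f \<in> hom A C" "\<And>i. f (gen i) = z i"
proof -
  interpret C: comm_group C by (rule C)
  have "z (i + m * n) = z i" for i m
  proof (induction m)
    case (Suc m)
    then show ?case using per[of "i + m * n"] by (simp add: ac_simps)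
  qed simp
  from this[of "i mod n" "i div n" for i] have mod: "z (i mod n) = z i" for i
    by simp
  have "word_eval C z (shift_word n i (fractional_Fibonacci_word k n)) = \<one>\<^bsub>C\<^esub>" for i
    using z n_pos
    by (simp add: C.word_eval_shift_fractional_Fibonacci_word mod rec C.m_comm[of "z i"])
  then obtain f where "f \<in> hom A C" "\<And>x. x \<in> {..<n} \<Longrightarrow> f (cls (generator x)) = z x"
    using z by (elim abelianization_universal[OF C, of z, rotated 2]) auto
  then show thesis
    using that n_pos by (simp add: gen_def mod)
qed

end

section \<open>Integer recurrences modulo \<open>m\<close> and homomorphisms to cyclic
  groups\<close>

fun lin_rec :: "nat \<Rightarrow> int \<Rightarrow> int \<Rightarrow> nat \<Rightarrow> int" where
  "lin_rec k u v 0 = u"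
| "lin_rec k u v (Suc 0) = v"
| "lin_rec k u v (Suc (Suc i)) = int k * lin_rec k u v (Suc i) + lin_rec k u v i"

lemma lin_rec_Suc:
  "lin_rec k u v (Suc i) = u * int (fractional_fib k i) + v * int (fractional_fib k (Suc i))"
proof (induction i rule: induct_nat_012)
  case (ge2 i)
  show ?case
    unfolding lin_rec.simps(3)[of k u v "Suc i"] ge2 by (simp add: algebra_simps)
qed simp_all

text \<open>The difference of the sequence and its shift by \<open>n\<close> satisfies the same
  linear recurrence, so divisibility of its first two terms propagates.\<close>

lemma lin_rec_periodic:
  assumes "m dvd lin_rec k u v n - u" "m dvd lin_rec k u v (Suc n) - v"
  shows "m dvd lin_rec k u v (i + n) - lin_rec k u v i"
proof (induction i rule: induct_nat_012)
  case (ge2 i)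
  have "lin_rec k u v (Suc (Suc i) + n) - lin_rec k u v (Suc (Suc i)) =
      int k * (lin_rec k u v (Suc i + n) - lin_rec k u v (Suc i))
      + (lin_rec k u v (i + n) - lin_rec k u v i)"
    by (simp add: algebra_simps)
  with ge2 show ?case by (metis dvd_add dvd_mult)
qed (use assms in simp_all)

context fractional_Fibonacci
begin

text \<open>The sequence \<open>lin_rec k u v\<close> becomes periodic modulo \<open>m\<close> and
  so defines a homomorphism, which sends \<open>gen 0\<close> to \<open>u\<close> and
  \<open>gen 1\<close> to \<open>v\<close>.\<close>

lemma hom_to_cyclic:
  assumes "int m dvd lin_rec k u v n - u" "int m dvd lin_rec k u v (Suc n) - v"
  obtains f where "f \<in> hom A (integer_mod_group m)"
    "\<And>a b :: int. f (gen 0 [^]\<^bsub>A\<^esub> a \<otimes>\<^bsub>A\<^esub> gen 1 [^]\<^bsub>A\<^esub> b) = (a * u + b * v) mod int m"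
proof -
  define z where "z i = lin_rec k u v i mod int m" for i
  have closed: "z i \<in> carrier (integer_mod_group m)" for i
    by (simp add: z_def carrier_integer_mod_group)
  have "z (i + n) = z i" for i
    using lin_rec_periodic[OF assms, of i] by (simp add: z_def mod_eq_dvd_iff)
  moreover have "z (Suc (Suc i)) = z (Suc i) [^]\<^bsub>integer_mod_group m\<^esub> k \<otimes>\<^bsub>integer_mod_group m\<^esub> z i" for i
    by (simp add: z_def mod_simps)
  ultimately obtain f where f: "f \<in> hom A (integer_mod_group m)" "\<And>i. f (gen i) = z i"
    using closed by (elim hom_from_recurrence[OF abelian_integer_mod_group, of z, rotated 3]) auto
  interpret f: group_hom A "integer_mod_group m" f
    by (intro group_hom.intro group_hom_axioms.intro A.is_group f group_integer_mod_group)
  have "f (gen 0 [^]\<^bsub>A\<^esub> a \<otimes>\<^bsub>A\<^esub> gen 1 [^]\<^bsub>A\<^esub> b) = (a * u + b * v) mod int m" for a b :: int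
    by (simp add: f.hom_int_pow f(2) int_pow_integer_mod_group z_def mod_simps)
  with f(1) that show thesis by blast
qed

text \<open>These are \<open>gen n = gen 0\<close> and \<open>gen (Suc n) = gen 1\<close>, expanded
  by \<open>gen_Suc\<close> and moved to one side: the two rows of the relation matrix.\<close>

lemma gen_powers_period:
  "gen 0 [^]\<^bsub>A\<^esub> (int (fractional_fib k (n - 1)) - 1) \<otimes>\<^bsub>A\<^esub> gen 1 [^]\<^bsub>A\<^esub> int (fractional_fib k n) = \<one>\<^bsub>A\<^esub>"
  "gen 0 [^]\<^bsub>A\<^esub> int (fractional_fib k n) \<otimes>\<^bsub>A\<^esub> gen 1 [^]\<^bsub>A\<^esub> (int (fractional_fib k (Suc n)) - 1) = \<one>\<^bsub>A\<^esub>"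
proof -
  have "gen 0 [^]\<^bsub>A\<^esub> int (fractional_fib k (n - 1)) \<otimes>\<^bsub>A\<^esub> gen 1 [^]\<^bsub>A\<^esub> int (fractional_fib k n) = gen 0"
    using gen_Suc[of "n - 1"] gen_periodic[of 0] n_pos by (simp add: int_pow_int)
  then show "gen 0 [^]\<^bsub>A\<^esub> (int (fractional_fib k (n - 1)) - 1) \<otimes>\<^bsub>A\<^esub> gen 1 [^]\<^bsub>A\<^esub> int (fractional_fib k n) = \<one>\<^bsub>A\<^esub>"
    by (simp add: A.int_pow_diff A.m_ac)
  have "gen 0 [^]\<^bsub>A\<^esub> int (fractional_fib k n) \<otimes>\<^bsub>A\<^esub> gen 1 [^]\<^bsub>A\<^esub> int (fractional_fib k (Suc n)) = gen 1"
    using gen_Suc[of n] gen_periodic[of 1] by (simp add: int_pow_int)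
  then show "gen 0 [^]\<^bsub>A\<^esub> int (fractional_fib k n) \<otimes>\<^bsub>A\<^esub> gen 1 [^]\<^bsub>A\<^esub> (int (fractional_fib k (Suc n)) - 1) = \<one>\<^bsub>A\<^esub>"
    by (simp add: A.int_pow_diff A.m_assoc[symmetric])
qed

text \<open>Every integer combination of the rows \<open>(p, q)\<close> and \<open>(q, r)\<close> is
  a relation.\<close>

lemma gen_powers_lattice:
  fixes s t :: int
  defines "p \<equiv> int (fractional_fib k (n - 1)) - 1" and "q \<equiv> int (fractional_fib k n)"
    and "r \<equiv> int (fractional_fib k (Suc n)) - 1"
  shows "gen 0 [^]\<^bsub>A\<^esub> (p * s + q * t) \<otimes>\<^bsub>A\<^esub> gen 1 [^]\<^bsub>A\<^esub> (q * s + r * t) = \<one>\<^bsub>A\<^esub>"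
proof -
  have "gen 0 [^]\<^bsub>A\<^esub> (p * s + q * t) \<otimes>\<^bsub>A\<^esub> gen 1 [^]\<^bsub>A\<^esub> (q * s + r * t) =
      (gen 0 [^]\<^bsub>A\<^esub> p \<otimes>\<^bsub>A\<^esub> gen 1 [^]\<^bsub>A\<^esub> q) [^]\<^bsub>A\<^esub> s \<otimes>\<^bsub>A\<^esub> (gen 0 [^]\<^bsub>A\<^esub> q \<otimes>\<^bsub>A\<^esub> gen 1 [^]\<^bsub>A\<^esub> r) [^]\<^bsub>A\<^esub> t"
    by (simp add: A.int_pow_distrib A.int_pow_pow A.int_pow_mult A.m_ac)
  then show ?thesis
    using gen_powers_period by (simp add: p_def q_def r_def)
qed

text \<open>Write \<open>(p, q) = d (p', q')\<close> with
  \<open>e p' + f q' = 1\<close>.  In the basis \<open>(p', q')\<close>, \<open>(-f, e)\<close> of the plane, the lattice of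
  relations is spanned by the multiples \<open>d\<close> and \<open>c\<close> of the basis vectors, where \<open>c d\<close> is the determinant; the
  coordinates of \<open>(a, b)\<close> are \<open>e a + f b\<close> and \<open>p' b - q' a\<close>.\<close>

theorem abelianization_iso:
  fixes d m :: nat
  defines "p \<equiv> int (fractional_fib k (n - 1)) - 1" and "q \<equiv> int (fractional_fib k n)"
  assumes d: "int d = gcd p q" and d0: "d > 0"
    and m: "int d * int m = \<bar>p\<^sup>2 + int k * p * q - q\<^sup>2\<bar>"
  shows "A \<cong> integer_mod_group d \<times>\<times> integer_mod_group m"
proof -
  obtain p' q' where pq: "p = int d * p'" "q = int d * q'"
    using d by (metis dvdE gcd_dvd1 gcd_dvd2)
  obtain e f where "e * p + f * q = int d"
    using d bezout_int by metis
  then have "int d * (e * p' + f * q') = int d * 1"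
    by (simp add: pq algebra_simps)
  then have bez: "e * p' + f * q' = 1"
    using d0 by (metis mult_cancel_left of_nat_0_eq_iff less_numeral_extra(3))
  define c where "c = p' * p + int k * p' * q - q' * q"
  have "int d * int m = \<bar>int d * c\<bar>"
    unfolding m by (simp add: c_def pq power2_eq_square algebra_simps)
  then have mc: "int m = \<bar>c\<bar>"
    using d0 by (simp add: abs_mult)
  have Fn1: "int (fractional_fib k (n - 1)) = p + 1" and Fn: "int (fractional_fib k n) = q"
    by (simp_all add: p_def q_def)
  have FSn: "int (fractional_fib k (Suc n)) = p + 1 + int k * q"
    using n_pos Fn1 Fn by (cases n) simp_all
  have rec_n: "lin_rec k u v n = u * (p + 1) + v * q" for u v
    using lin_rec_Suc[of k u v "n - 1"] n_pos Fn1 Fn by simp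
  have rec_Sn: "lin_rec k u v (Suc n) = u * q + v * (p + 1 + int k * q)" for u v
    using lin_rec_Suc[of k u v n] FSn Fn by simp
  \<comment> \<open>\<open>e\<close> and \<open>f\<close> are the first coordinates of
    \<open>gen 0\<close> and \<open>gen 1\<close>; the differences are integer combinations of
    \<open>p\<close> and \<open>q\<close>, hence multiples of \<open>d\<close>.\<close>
  have "int d dvd lin_rec k e f n - e" "int d dvd lin_rec k e f (Suc n) - f"
    unfolding rec_n rec_Sn pq
    by (rule dvdI[of _ _ "e * p' + f * q'"], simp add: algebra_simps)
      (rule dvdI[of _ _ "e * q' + f * (p' + int k * q')"], simp add: algebra_simps)
  then obtain g where g: "g \<in> hom A (integer_mod_group d)"
    "\<And>a b :: int. g (gen 0 [^]\<^bsub>A\<^esub> a \<otimes>\<^bsub>A\<^esub> gen 1 [^]\<^bsub>A\<^esub> b) = (a * e + b * f) mod int d"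
    by (rule hom_to_cyclic) (rule that)
  \<comment> \<open>Likewise \<open>- q'\<close> and \<open>p'\<close> are the second coordinates of
    \<open>gen 0\<close> and \<open>gen 1\<close>; on the two rows the second coordinate takes the
    values \<open>0\<close> and \<open>c\<close>.\<close>
  have "lin_rec k (- q') p' n - (- q') = 0" "lin_rec k (- q') p' (Suc n) - p' = c"
    unfolding rec_n rec_Sn by (simp_all add: pq c_def algebra_simps)
  then have "int m dvd lin_rec k (- q') p' n - (- q')" "int m dvd lin_rec k (- q') p' (Suc n) - p'"
    by (simp_all add: mc)
  then obtain h where h: "h \<in> hom A (integer_mod_group m)"
    "\<And>a b :: int. h (gen 0 [^]\<^bsub>A\<^esub> a \<otimes>\<^bsub>A\<^esub> gen 1 [^]\<^bsub>A\<^esub> b) = (a * - q' + b * p') mod int m"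
    by (rule hom_to_cyclic) (rule that)
  define \<phi> where "\<phi> x = (g x, h x)" for x
  interpret \<phi>: group_hom A "integer_mod_group d \<times>\<times> integer_mod_group m" \<phi>
    unfolding \<phi>_def[abs_def]
    by (intro group_hom.intro group_hom_axioms.intro A.is_group DirProd_group group_integer_mod_group)
      (simp add: hom_paired g h)
  have \<phi>: "\<phi> (gen 0 [^]\<^bsub>A\<^esub> a \<otimes>\<^bsub>A\<^esub> gen 1 [^]\<^bsub>A\<^esub> b) =
      ((a * e + b * f) mod int d, (b * p' - a * q') mod int m)" for a b :: int
    by (simp add: \<phi>_def g h del: One_nat_def)
  have "x = \<one>\<^bsub>A\<^esub>" if x: "x \<in> carrier A" "\<phi> x = \<one>\<^bsub>integer_mod_group d \<times>\<times> integer_mod_group m\<^esub>" for x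
  proof -
    obtain a b :: int where ab: "x = gen 0 [^]\<^bsub>A\<^esub> a \<otimes>\<^bsub>A\<^esub> gen 1 [^]\<^bsub>A\<^esub> b"
      using x(1) by (rule ex_gen_powers)
    have "int d dvd a * e + b * f" "c dvd b * p' - a * q'"
      using x(2) \<phi>[of a b] by (simp_all add: ab mc mod_eq_0_iff_dvd)
    then obtain xx yy :: int where xx: "a * e + b * f = int d * xx" and yy: "b * p' - a * q' = c * yy"
      unfolding dvd_def by (elim exE)
    \<comment> \<open>The first row has coordinates \<open>(d, 0)\<close> and the second
      \<open>(d * \<alpha>, c)\<close>. A vector with coordinates \<open>(d * xx, c * yy)\<close> is
      therefore \<open>xx - \<alpha> * yy\<close> times the first row plus \<open>yy\<close> times
      the second.\<close>
    define \<alpha> where "\<alpha> = e * q' + f * (p' + int k * q')"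
    have "a = a * (e * p' + f * q')" "b = b * (e * p' + f * q')"
      by (simp_all add: bez)
    then have "a = (a * e + b * f) * p' - (b * p' - a * q') * f"
        "b = (a * e + b * f) * q' + (b * p' - a * q') * e"
      by (simp_all add: algebra_simps)
    then have a: "a = int d * xx * p' - c * yy * f" and b: "b = int d * xx * q' + c * yy * e"
      unfolding xx yy by simp_all
    have q_eq: "q = int d * (\<alpha> * p') - c * f"
    proof -
      have "int d * (\<alpha> * p') - c * f = int d * q' * (e * p' + f * q')"
        unfolding \<alpha>_def c_def pq by (simp add: algebra_simps)
      then show ?thesis by (simp add: bez pq)
    qed
    have r_eq: "p + int k * q = int d * (\<alpha> * q') + c * e"
    proof -
      have "int d * (\<alpha> * q') + c * e = int d * (p' + int k * q') * (e * p' + f * q')"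
        unfolding \<alpha>_def c_def pq by (simp add: algebra_simps)
      then show ?thesis by (simp add: bez pq algebra_simps)
    qed
    have "a = p * (xx - \<alpha> * yy) + q * yy"
      by (subst q_eq) (simp add: a pq algebra_simps)
    moreover have "b = q * (xx - \<alpha> * yy) + (int (fractional_fib k (Suc n)) - 1) * yy"
    proof -
      have "b = int d * q' * (xx - \<alpha> * yy) + (int d * (\<alpha> * q') + c * e) * yy"
        by (simp add: b algebra_simps)
      then show ?thesis unfolding r_eq[symmetric] FSn by (simp add: pq algebra_simps)
    qed
    ultimately show ?thesis
      unfolding ab using gen_powers_lattice[of "xx - \<alpha> * yy" yy] by (simp add: p_def q_def)
  qed
  then have "inj_on \<phi> (carrier A)"
    by (intro \<phi>.trivial_ker_imp_inj) (auto simp: kernel_def)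
  moreover have "\<phi> ` carrier A = carrier (integer_mod_group d \<times>\<times> integer_mod_group m)"
  proof (intro antisym subsetI)
    fix y assume y: "y \<in> carrier (integer_mod_group d \<times>\<times> integer_mod_group m)"
    obtain s t where st: "y = (s, t)" by (cases y)
    \<comment> \<open>The combination of the two basis vectors with coordinates \<open>s\<close> and
      \<open>t\<close>.\<close>
    define a b where "a = s * p' - t * f" and "b = s * q' + t * e"
    have "a * e + b * f = s * (e * p' + f * q')" "b * p' - a * q' = t * (e * p' + f * q')"
      by (simp_all add: a_def b_def algebra_simps)
    then have "\<phi> (gen 0 [^]\<^bsub>A\<^esub> a \<otimes>\<^bsub>A\<^esub> gen 1 [^]\<^bsub>A\<^esub> b) = (s mod int d, t mod int m)"
      unfolding \<phi> bez by simp
    also have "\<dots> = y"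
      using y by (auto simp: st carrier_integer_mod_group split: if_splits)
    finally show "y \<in> \<phi> ` carrier A"
      by (rule image_eqI[OF sym]) simp
  qed (auto intro: \<phi>.hom_closed simp del: carrier_DirProd)
  ultimately show ?thesis
    using \<phi>.homh by (auto simp: is_iso_def iso_def bij_betw_def)
qed

end

section \<open>Invariant factors\<close>

lemma fractional_fib_pos: "k > 0 \<Longrightarrow> j > 0 \<Longrightarrow> fractional_fib k j > 0"
  by (induction k j rule: fractional_fib.induct) auto

text \<open>Induction moves one unit of the index from \<open>i\<close> to \<open>j\<close>, which
  is why \<open>j\<close> is arbitrary.\<close>

lemma fractional_fib_add:
  "fractional_fib k (i + Suc j) =
     fractional_fib k i * fractional_fib k j + fractional_fib k (Suc i) * fractional_fib k (Suc j)"
proof (induction i arbitrary: j)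
  case (Suc i)
  show ?case using Suc.IH[of "Suc j"] by (simp add: algebra_simps)
qed simp

text \<open>The quadratic form is the one giving the determinant; the step from
  \<open>(x, y)\<close> to \<open>(y, k * y + x)\<close> changes its sign.\<close>

lemma fractional_fib_cassini:
  fixes k i :: nat
  defines "x \<equiv> int (fractional_fib k i)" and "y \<equiv> int (fractional_fib k (Suc i))"
  shows "x\<^sup>2 + int k * x * y - y\<^sup>2 = - ((-1) ^ i)"
  unfolding x_def y_def
  by (induction i) (simp_all add: power2_eq_square algebra_simps)

text \<open>Modulo 2 the sequence runs 0, 1 with period two for even \<open>k\<close>, and 0, 1, 1
  with period three for odd \<open>k\<close>.\<close>

lemma even_fractional_fib_iff:
  "even (fractional_fib k j) \<longleftrightarrow> (if even k then even j else 3 dvd j)"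
proof (induction j rule: induct_nat_012)
  case (ge2 j)
  then show ?case by (cases "even k") (simp_all, presburger)
qed simp_all

lemma gcd_2_right: "gcd (a :: nat) 2 = (if even a then 2 else 1)"
  by (auto simp: coprime_iff_gcd_eq_1[symmetric])

lemma gcd_mult_coprime_int:
  fixes a x y u v :: int
  assumes "u * x + v * y = 1"
  shows "gcd (a * x) (a * y) = \<bar>a\<bar>"
proof -
  have "coprime x y"
    using assms by (metis coprimeI dvd_add dvd_mult)
  then show ?thesis by (simp add: gcd_mult_distrib_int[symmetric])
qed

section \<open>The gcd and the determinant according to \<open>n\<close> modulo 4\<close>

lemma abelianization_fractional_Fibonacci:
  fixes k n d m :: nat
  defines "p \<equiv> int (fractional_fib k (n - 1)) - 1" and "q \<equiv> int (fractional_fib k n)"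
  assumes "n > 0" "k > 0" "int d = gcd p q" "int d * int m = \<bar>p\<^sup>2 + int k * p * q - q\<^sup>2\<bar>"
  shows "abelianization (fractional_Fibonacci_group k n) \<cong> integer_mod_group d \<times>\<times> integer_mod_group m"
proof -
  interpret fractional_Fibonacci k n by standard fact
  \<comment> \<open>Positivity of \<open>q\<close> makes the gcd positive.\<close>
  have "q > 0" using fractional_fib_pos[of k n] assms by simp
  then have "d > 0" using assms(5) by (metis gcd_pos_int of_nat_0_less_iff less_irrefl)
  then show ?thesis
    unfolding abelianization_eq by (rule abelianization_iso[OF assms(5)[unfolded p_def q_def] _ assms(6)[unfolded p_def q_def]])
qed

text \<open>With \<open>p = x - 1\<close> and \<open>q = y\<close>, Cassini cancels the quadratic
  part of the determinant and leaves \<open>- L\<close>. The gcd divides 2, so parity decides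
  it.\<close>

lemma abelianization_odd:
  fixes k n :: nat
  assumes k: "k > 0" and n: "odd n"
  defines "d \<equiv> if 3 dvd n then gcd (k + 1) 2 else 1"
  shows "abelianization (fractional_Fibonacci_group k n) \<cong> integer_mod_group d \<times>\<times>
    integer_mod_group ((fractional_fib k (n + 1) + fractional_fib k (n - 1)) div d)"
proof -
  obtain i where i: "n = Suc i" "even i" using n by (cases n) auto
  define x where "x = int (fractional_fib k i)"
  define y where "y = int (fractional_fib k (Suc i))"
  define L where "L = fractional_fib k (n + 1) + fractional_fib k (n - 1)"
  have cassini: "x\<^sup>2 + int k * x * y - y\<^sup>2 = - 1"
    using fractional_fib_cassini[of k i] i by (simp add: x_def y_def)
  have L: "int L = 2 * x + int k * y"
    by (simp add: L_def x_def y_def i)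
  have "(x - 1)\<^sup>2 + int k * (x - 1) * y - y\<^sup>2 = (x\<^sup>2 + int k * x * y - y\<^sup>2) + 1 - (2 * x + int k * y)"
    by (simp add: power2_eq_square algebra_simps)
  then have D: "(x - 1)\<^sup>2 + int k * (x - 1) * y - y\<^sup>2 = - int L"
    unfolding cassini L by simp
  define g where "g = gcd (x - 1) y"
  have g: "g dvd x - 1" "g dvd y" "g \<ge> 0" by (simp_all add: g_def)
  \<comment> \<open>Cassini again, rewritten as an integer combination of \<open>x - 1\<close> and
    \<open>y\<close>.\<close>
  have "2 = y * (y - int k * x) - (x - 1) * (x + 1)"
    using cassini by (simp add: power2_eq_square algebra_simps)
  then have "g dvd 2" using g by (metis dvd_diff dvd_mult2)
  then have g12: "g = 1 \<or> g = 2"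
    using g(3) zdvd_imp_le[of g 2] by (cases "g = 0") auto
  \<comment> \<open>If \<open>y\<close> is even then \<open>x\<close> is odd by Cassini, so
    \<open>x - 1\<close> is even too.\<close>
  have "even y \<Longrightarrow> odd x"
    using cassini by (metis even_add even_diff even_minus even_mult_iff odd_one even_power)
  then have "even g \<longleftrightarrow> even y"
    unfolding g_def by auto
  also have "\<dots> \<longleftrightarrow> odd k \<and> 3 dvd n"
    using n by (simp add: y_def i(1) even_fractional_fib_iff del: fractional_fib.simps)
  finally have gd: "g = int d"
    using g12 by (auto simp: d_def gcd_2_right)
  have "g dvd (x - 1)\<^sup>2 + int k * (x - 1) * y - y\<^sup>2"
    using g by (simp add: power2_eq_square)
  then have "int d * int (L div d) = int L"
    unfolding D gd by (simp flip: of_nat_mult)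
  then have "abelianization (fractional_Fibonacci_group k n) \<cong> integer_mod_group d \<times>\<times> integer_mod_group (L div d)"
    using D gd k unfolding i(1)
    by (intro abelianization_fractional_Fibonacci) (simp_all add: g_def x_def y_def)
  then show ?thesis by (simp add: L_def)
qed

text \<open>The addition formula at \<open>i, i\<close> and at \<open>Suc i, i\<close>. For
  \<open>m = Suc i\<close>, the factor \<open>2 * x + k * y\<close> is the sum of the terms at
  \<open>m + 1\<close> and \<open>m - 1\<close>.\<close>

lemma fractional_fib_double:
  fixes k i :: nat
  defines "x \<equiv> int (fractional_fib k i)" and "y \<equiv> int (fractional_fib k (Suc i))"
  shows "int (fractional_fib k (2 * Suc i - 1)) = x\<^sup>2 + y\<^sup>2"
    and "int (fractional_fib k (2 * Suc i)) = y * (2 * x + int k * y)"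
proof -
  have "2 * Suc i - 1 = i + Suc i" "2 * Suc i = Suc i + Suc i" by simp_all
  then show "int (fractional_fib k (2 * Suc i - 1)) = x\<^sup>2 + y\<^sup>2"
    and "int (fractional_fib k (2 * Suc i)) = y * (2 * x + int k * y)"
    by (simp_all only: fractional_fib_add fractional_fib.simps(3) of_nat_add of_nat_mult x_def y_def
        power2_eq_square) (simp add: algebra_simps)
qed

lemma abelianization_twice_odd:
  fixes k m :: nat
  assumes k: "k > 0" and m: "odd m"
  defines "L \<equiv> fractional_fib k (m + 1) + fractional_fib k (m - 1)"
  shows "abelianization (fractional_Fibonacci_group k (2 * m)) \<cong> integer_mod_group L \<times>\<times> integer_mod_group L"
proof -
  obtain i where i: "m = Suc i" "even i" using m by (cases m) auto
  define x where "x = int (fractional_fib k i)"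
  define y where "y = int (fractional_fib k (Suc i))"
  have cassini: "x\<^sup>2 + int k * x * y - y\<^sup>2 = - 1"
    using fractional_fib_cassini[of k i] i by (simp add: x_def y_def)
  have L: "int L = 2 * x + int k * y"
    by (simp add: L_def x_def y_def i)
  define p q where "p = int (fractional_fib k (2 * m - 1)) - 1" and "q = int (fractional_fib k (2 * m))"
  \<comment> \<open>The constant \<open>- 1\<close> is replaced by the Cassini form, which makes
    \<open>p\<close> homogeneous and lets \<open>L\<close> factor out.\<close>
  have "p = x\<^sup>2 + y\<^sup>2 + (x\<^sup>2 + int k * x * y - y\<^sup>2)"
    unfolding cassini unfolding p_def i x_def y_def fractional_fib_double by simp
  then have p: "p = int L * x"
    unfolding L by (simp add: power2_eq_square algebra_simps)
  have q: "q = int L * y"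
    unfolding L q_def i x_def y_def fractional_fib_double by (rule mult.commute)
  have "gcd p q = int L"
    unfolding p q
    \<comment> \<open>Cassini read as a Bezout identity for \<open>x\<close> and
      \<open>y\<close>.\<close>
    by (subst gcd_mult_coprime_int[of "- x - int k * y" _ y])
      (use cassini in \<open>simp_all add: power2_eq_square algebra_simps\<close>)
  moreover have "p\<^sup>2 + int k * p * q - q\<^sup>2 = (int L)\<^sup>2 * (x\<^sup>2 + int k * x * y - y\<^sup>2)"
    unfolding p q by (simp add: power2_eq_square algebra_simps)
  then have "int L * int L = \<bar>p\<^sup>2 + int k * p * q - q\<^sup>2\<bar>"
    unfolding cassini by (simp add: power2_eq_square)
  ultimately show ?thesis
    using k m unfolding p_def q_def by (intro abelianization_fractional_Fibonacci) (auto elim: oddE)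
qed

lemma abelianization_twice_even:
  fixes k m :: nat
  assumes k: "k > 0" and m: "even m" "m > 0"
  shows "abelianization (fractional_Fibonacci_group k (2 * m)) \<cong>
    integer_mod_group (gcd k 2 * fractional_fib k m) \<times>\<times>
    integer_mod_group ((k\<^sup>2 + 4) * fractional_fib k m div gcd k 2)"
proof -
  obtain i where i: "m = Suc i" "odd i" using m by (cases m) auto
  define x where "x = int (fractional_fib k i)"
  define y where "y = int (fractional_fib k (Suc i))"
  have cassini: "x\<^sup>2 + int k * x * y - y\<^sup>2 = 1"
    using fractional_fib_cassini[of k i] i by (simp add: x_def y_def)
  define u v where "u = 2 * x + int k * y" and "v = 2 * y - int k * x"
  define p q where "p = int (fractional_fib k (2 * m - 1)) - 1" and "q = int (fractional_fib k (2 * m))"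
  \<comment> \<open>Here the Cassini form equals \<open>1\<close>, so it is subtracted; now
    \<open>y\<close> factors out instead.\<close>
  have "p = x\<^sup>2 + y\<^sup>2 - (x\<^sup>2 + int k * x * y - y\<^sup>2)"
    unfolding cassini unfolding p_def i x_def y_def fractional_fib_double by simp
  then have p: "p = y * v"
    unfolding v_def by (simp add: power2_eq_square algebra_simps)
  have q: "q = y * u"
    unfolding u_def q_def i x_def y_def fractional_fib_double by simp
  \<comment> \<open>Combinations of \<open>u\<close> and \<open>v\<close> with values
    \<open>2\<close> and \<open>k\<close>: hence \<open>gcd v u\<close> divides both, and conversely
    every common divisor of \<open>k\<close> and 2 divides \<open>u\<close> and
    \<open>v\<close>.\<close>
  have "x * u - y * v = 2 * (x\<^sup>2 + int k * x * y - y\<^sup>2)"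
    "y * u - (int k * y + x) * v = int k * (x\<^sup>2 + int k * x * y - y\<^sup>2)"
    by (simp_all add: u_def v_def power2_eq_square algebra_simps)
  then have "gcd v u dvd 2" "gcd v u dvd int k"
    unfolding cassini by (metis dvd_diff dvd_mult gcd_dvd1 gcd_dvd2 mult.right_neutral)+
  then have "gcd v u = gcd (int k) 2"
    by (intro zdvd_antisym_nonneg) (simp_all add: u_def v_def)
  then have "gcd p q = int (gcd k 2 * fractional_fib k m)"
    unfolding p q by (simp add: gcd_mult_left y_def i abs_mult gcd_int_int_eq[of k 2, simplified])
  moreover have "p\<^sup>2 + int k * p * q - q\<^sup>2 = - y\<^sup>2 * ((int k)\<^sup>2 + 4) * (x\<^sup>2 + int k * x * y - y\<^sup>2)"
    unfolding p q u_def v_def by (simp add: power2_eq_square algebra_simps)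
  then have "\<bar>p\<^sup>2 + int k * p * q - q\<^sup>2\<bar> = int (fractional_fib k m * ((k\<^sup>2 + 4) * fractional_fib k m))"
    unfolding cassini by (simp add: y_def i power2_eq_square abs_mult)
  moreover have "gcd k 2 dvd (k\<^sup>2 + 4) * fractional_fib k m"
    \<comment> \<open>\<open>gcd k 2\<close> divides both the square of \<open>k\<close> and 4, so
      the division in the second factor is exact.\<close>
    by (intro dvd_mult2 dvd_add) (auto simp: power2_eq_square intro: dvd_trans[OF gcd_dvd2])
  then have "gcd k 2 * fractional_fib k m * ((k\<^sup>2 + 4) * fractional_fib k m div gcd k 2) =
      fractional_fib k m * ((k\<^sup>2 + 4) * fractional_fib k m)"
    by (metis dvd_mult_div_cancel mult.assoc mult.commute)
  ultimately show ?thesis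
    using k m unfolding p_def q_def
    by (intro abelianization_fractional_Fibonacci) (simp_all flip: of_nat_mult)
qed

section \<open>Assembling the residues modulo 12\<close>

lemma trivial_times_integer_mod_group:
  "integer_mod_group 1 \<times>\<times> integer_mod_group m \<cong> integer_mod_group m"
proof -
  have "snd \<in> iso (integer_mod_group 1 \<times>\<times> integer_mod_group m) (integer_mod_group m)"
    by (auto simp: iso_def hom_def bij_betw_def inj_on_def carrier_integer_mod_group mult_DirProd'
        image_iff)
  then show ?thesis by (auto simp: is_iso_def)
qed

theorem corollary4p3:
  fixes n k :: nat
  assumes "n \<ge> 1" and "k \<ge> 1"
  shows
    "(n mod 12 \<in> {1, 5, 7, 11} \<longrightarrow>
        abelianization (fractional_Fibonacci_group k n) \<cong>
          integer_mod_group (fractional_fib k (n + 1) + fractional_fib k (n - 1))) \<and>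
     (n mod 12 \<in> {3, 9} \<longrightarrow>
        abelianization (fractional_Fibonacci_group k n) \<cong>
          integer_mod_group (gcd (k + 1) 2) \<times>\<times>
          integer_mod_group
            ((fractional_fib k (n + 1) + fractional_fib k (n - 1)) div gcd (k + 1) 2)) \<and>
     (n mod 12 \<in> {2, 6, 10} \<longrightarrow>
        abelianization (fractional_Fibonacci_group k n) \<cong>
          integer_mod_group (fractional_fib k (n div 2 + 1) + fractional_fib k (n div 2 - 1)) \<times>\<times>
          integer_mod_group (fractional_fib k (n div 2 + 1) + fractional_fib k (n div 2 - 1))) \<and>
     (n mod 12 \<in> {0, 4, 8} \<longrightarrow>
        abelianization (fractional_Fibonacci_group k n) \<cong>
          integer_mod_group (gcd k 2 * fractional_fib k (n div 2)) \<times>\<times>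
          integer_mod_group ((k\<^sup>2 + 4) * fractional_fib k (n div 2) div gcd k 2))"
proof (intro conjI impI)
  assume "n mod 12 \<in> {1, 5, 7, 11}"
  then have "odd n" "\<not> 3 dvd n" by (auto; presburger)+
  with abelianization_odd[of k n] assms
  \<comment> \<open>For odd \<open>n\<close> prime to 3 the gcd is 1, and the trivial first factor
    is then dropped.\<close>
  have "abelianization (fractional_Fibonacci_group k n) \<cong> integer_mod_group 1 \<times>\<times>
      integer_mod_group (fractional_fib k (n + 1) + fractional_fib k (n - 1))"
    by simp
  then show "abelianization (fractional_Fibonacci_group k n) \<cong>
      integer_mod_group (fractional_fib k (n + 1) + fractional_fib k (n - 1))"
    by (rule iso_trans) (rule trivial_times_integer_mod_group)
next
  assume "n mod 12 \<in> {3, 9}"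
  then have "odd n" "3 dvd n" by (auto; presburger)+
  with abelianization_odd[of k n] assms
  show "abelianization (fractional_Fibonacci_group k n) \<cong> integer_mod_group (gcd (k + 1) 2) \<times>\<times>
      integer_mod_group ((fractional_fib k (n + 1) + fractional_fib k (n - 1)) div gcd (k + 1) 2)"
    by simp
next
  assume "n mod 12 \<in> {2, 6, 10}"
  then have "odd (n div 2)" "2 * (n div 2) = n" by (auto; presburger)+
  with abelianization_twice_odd[of k "n div 2"] assms
  show "abelianization (fractional_Fibonacci_group k n) \<cong>
      integer_mod_group (fractional_fib k (n div 2 + 1) + fractional_fib k (n div 2 - 1)) \<times>\<times>
      integer_mod_group (fractional_fib k (n div 2 + 1) + fractional_fib k (n div 2 - 1))"
    by simp
next
  assume "n mod 12 \<in> {0, 4, 8}"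
  then have "even (n div 2)" "2 * (n div 2) = n" by (auto; presburger)+
  with abelianization_twice_even[of k "n div 2"] assms
  show "abelianization (fractional_Fibonacci_group k n) \<cong>
      integer_mod_group (gcd k 2 * fractional_fib k (n div 2)) \<times>\<times>
      integer_mod_group ((k\<^sup>2 + 4) * fractional_fib k (n div 2) div gcd k 2)"
    by simp
qed

end
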